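(* Assume that the travel cost between any two locations is less than or equal to $\frac{1}{2|R|}$ times the minimum reward $w^{\min}=\min_{d\in D}w_d$ of a demand. Then Algorithm $\mathcal{A}$ (run ignoring travel costs, i.e. as if they were zero) is a $2|R|$-approximation algorithm for $mRmDc$ instances with the same starting location for every resource.
   Context: Problem $mRmD$ (heterogeneous multi-resource allocation with subset demand requests). An instance consists of: a finite set $D$ of demands; a finite set $R$ of resource types; for each $r\in R$ a finite set $S^r$ of starting locations and, for each $s\in S^r$, a number $l_s^r$ of resources of type $r$ starting at $s$; for each demand $d\in D$ a nonempty set $M_d\subseteq R$ of required resource types, a service start time $\tau_d\ge 0$, a service duration $\Delta_d>0$ and a reward $w_d\ge 0$; and travel times $f_{xy}\ge 0$ between any two locations ($f_{ij}$ is the travel time between the locations of demands $i$ and $j$, and $f_{sd}$ that from starting location $s$ to the location of demand $d$). All these numbers are integers. Demand $d$ requires one unit of every resource type in $M_d$ simultaneously at time $\tau_d$ for duration $\Delta_d$. A resource of type $r$ starting at $s\in S^r$ can serve $d$ as its first demand iff $r\in M_d$ and $f_{sd}\le\tau_d$; a resource of type $r$ can serve $j$ immediately after $i$ iff $r\in M_i\cap M_j$ and $\tau_i+\Delta_i+f_{ij}\le\tau_j$. A feasible solution assigns to each resource a (possibly empty) path, i.e. a sequence of demands whose first element can be served first and in which each consecutive pair can be served one immediately after the other. Demand $d$ is met if, for every $r\in M_d$, at least one resource of type $r$ has $d$ on its path. The objective of $mRmD$ is to maximize the sum of $w_d$ over met demands $d$. Problem $mRmDc$: in addition there are integer travel costs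 $c_{sd}\ge0$ (from starting location $s$ to the location of demand $d$) and $c_{ij}\ge0$ (between the locations of demands $i$ and $j$). The feasible solutions are the same, and the objective is to maximize the sum of the rewards of met demands minus the total travel cost, where each resource pays $c_{sd}$ for going from its starting location $s$ to its first demand $d$ and $c_{ij}$ for each consecutive pair $(i,j)$ of demands on its path. An $\alpha$-approximation algorithm is an algorithm that, for every instance, returns a feasible solution with objective value at least $\frac1\alpha$ times the optimal objective value, in time polynomial in the size of the instance. Resource types are labeled $1,\dots,|R|$ so that $m_1\le m_2\le\dots\le m_{|R|}$, where $m_r$ is the number of resources of type $r$. For a current demand set $D$, let $D^r=\{i\in D: r\in M_i\}$, and let $1R1D^r$ be the single-resource-type problem (without travel costs) obtained by keeping only the $m_r$ resources of type $r$ and the demands $D^r$, each regarded as requiring only type $r$; it is solved to optimality in polynomial time as a minimum cost flow problem in which each demand is visited by at most one resource. Algorithm $\mathcal{A}$: start with value $0$ (empty solution). For $r=1,\dots,|R|$ in order: solve $1R1D^r$ optimally for the current demand set $D$; if its optimal value is at least the best value so far, record it as the new best; then replace $D$ by $D\setminus D^r$. Output the best value, together with the corresponding solution, which serves the demands met in the recorded optimal solution of $1R1D^r$, resources of the other types required by these demands following the schedules of the type-$r$ resources in that solution (each met demand being visited by exactly one resource of each type it requires).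
   Formalization: The travel times are additionally assumed to satisfy the triangle inequality (for trips ending at demand locations); without it the algorithm's output may be infeasible or fall short of the ratio. *)

theory Defs
  imports
    "HOL-Computational_Algebra.Polynomial"
    "HOL-Library.Log_Nat"
    "HOL-Library.Time_Functions"
begin

section \<open>Instances\<close>

text \<open>
  Starting locations are themselves locations; a demand \<open>d\<close> is served at \<open>dloc I d\<close>. Hence
  \<open>f\<^sub>s\<^sub>d\<close> is \<open>travel I s (dloc I d)\<close> and \<open>f\<^sub>i\<^sub>j\<close> is \<open>travel I (dloc I i) (dloc I j)\<close>, likewise for the
  travel costs. Finite sets are duplicate-free lists, since an algorithm has to traverse them.
  The remaining fields are only meaningful on the listed demands, types and locations.
\<close>

record ('d, 'r, 'l) mrmd =
  demands :: "'d list"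
  types :: "'r list"
  starts :: "'r \<Rightarrow> 'l list"
  num :: "'r \<Rightarrow> 'l \<Rightarrow> nat"
  req :: "'d \<Rightarrow> 'r list"
  start_time :: "'d \<Rightarrow> nat"
  duration :: "'d \<Rightarrow> nat"
  reward :: "'d \<Rightarrow> nat"
  dloc :: "'d \<Rightarrow> 'l"
  travel :: "'l \<Rightarrow> 'l \<Rightarrow> nat"

record ('d, 'r, 'l) mrmdc = "('d, 'r, 'l) mrmd" +
  cost :: "'l \<Rightarrow> 'l \<Rightarrow> nat"

definition valid :: "('d, 'r, 'l, 'x) mrmd_scheme \<Rightarrow> bool" where
  "valid I \<longleftrightarrow>
     distinct (demands I) \<and> distinct (types I) \<and>
     (\<forall>r\<in>set (types I). distinct (starts I r)) \<and>
     (\<forall>d\<in>set (demands I).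
        req I d \<noteq> [] \<and> distinct (req I d) \<and> set (req I d) \<subseteq> set (types I) \<and> duration I d > 0)"

definition demand_locations :: "('d, 'r, 'l, 'x) mrmd_scheme \<Rightarrow> 'l set" where
  "demand_locations I = dloc I ` set (demands I)"

definition locations :: "('d, 'r, 'l, 'x) mrmd_scheme \<Rightarrow> 'l set" where
  "locations I = (\<Union>r\<in>set (types I). set (starts I r)) \<union> demand_locations I"

text \<open>
  Every trip of a resource ends at the location of a demand. The inequality is what allows a
  resource to leave out a demand of a schedule that it follows.
\<close>

definition triangle_inequality :: "('d, 'r, 'l, 'x) mrmd_scheme \<Rightarrow> bool" where
  "triangle_inequality I \<longleftrightarrow>
     (\<forall>x\<in>locations I. \<forall>y\<in>demand_locations I. \<forall>z\<in>demand_locations I.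
        travel I x z \<le> travel I x y + travel I y z)"

definition min_reward :: "('d, 'r, 'l, 'x) mrmd_scheme \<Rightarrow> nat" where
  "min_reward I = Min (reward I ` set (demands I))"


section \<open>Solutions\<close>

text \<open>\<open>(r, s, k)\<close> is the \<open>k\<close>-th resource of type \<open>r\<close> starting at \<open>s\<close>.\<close>

type_synonym ('r, 'l) resource = "'r \<times> 'l \<times> nat"
type_synonym ('d, 'r, 'l) schedule = "('r, 'l) resource \<Rightarrow> 'd list"

definition resources :: "('d, 'r, 'l, 'x) mrmd_scheme \<Rightarrow> ('r, 'l) resource set" where
  "resources I = {(r, s, k). r \<in> set (types I) \<and> s \<in> set (starts I r) \<and> k < num I r s}"

definition same_start :: "('d, 'r, 'l, 'x) mrmd_scheme \<Rightarrow> bool" where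
  "same_start I \<longleftrightarrow> (\<exists>s0. \<forall>(r, s, k)\<in>resources I. s = s0)"

definition serves_first :: "('d, 'r, 'l, 'x) mrmd_scheme \<Rightarrow> 'r \<Rightarrow> 'l \<Rightarrow> 'd \<Rightarrow> bool" where
  "serves_first I r s d \<longleftrightarrow> r \<in> set (req I d) \<and> travel I s (dloc I d) \<le> start_time I d"

definition serves_next :: "('d, 'r, 'l, 'x) mrmd_scheme \<Rightarrow> 'r \<Rightarrow> 'd \<Rightarrow> 'd \<Rightarrow> bool" where
  "serves_next I r i j \<longleftrightarrow>
     r \<in> set (req I i) \<inter> set (req I j) \<and>
     start_time I i + duration I i + travel I (dloc I i) (dloc I j) \<le> start_time I j"

definition is_path :: "('d, 'r, 'l, 'x) mrmd_scheme \<Rightarrow> ('r, 'l) resource \<Rightarrow> 'd list \<Rightarrow> bool" where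
  "is_path I = (\<lambda>(r, s, k) p.
     set p \<subseteq> set (demands I) \<and>
     (p \<noteq> [] \<longrightarrow> serves_first I r s (hd p)) \<and>
     successively (serves_next I r) p)"

definition feasible :: "('d, 'r, 'l, 'x) mrmd_scheme \<Rightarrow> ('d, 'r, 'l) schedule \<Rightarrow> bool" where
  "feasible I P \<longleftrightarrow> (\<forall>\<rho>\<in>resources I. is_path I \<rho> (P \<rho>))"

definition met :: "('d, 'r, 'l, 'x) mrmd_scheme \<Rightarrow> ('d, 'r, 'l) schedule \<Rightarrow> 'd set" where
  "met I P =
     {d \<in> set (demands I). \<forall>r\<in>set (req I d). \<exists>\<rho>\<in>resources I. fst \<rho> = r \<and> d \<in> set (P \<rho>)}"

definition total_reward :: "('d, 'r, 'l, 'x) mrmd_scheme \<Rightarrow> ('d, 'r, 'l) schedule \<Rightarrow> nat" where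
  "total_reward I P = (\<Sum>d\<in>met I P. reward I d)"

fun path_cost :: "('d, 'r, 'l) mrmdc \<Rightarrow> 'l \<Rightarrow> 'd list \<Rightarrow> nat" where
  "path_cost I x [] = 0"
| "path_cost I x (d # ds) = cost I x (dloc I d) + path_cost I (dloc I d) ds"

definition net_reward :: "('d, 'r, 'l) mrmdc \<Rightarrow> ('d, 'r, 'l) schedule \<Rightarrow> int" where
  "net_reward I P =
     int (total_reward I P) - int (\<Sum>(r, s, k)\<in>resources I. path_cost I s (P (r, s, k)))"

text \<open>
  For valid instances both maxima exist: start times increase along a path, so paths have bounded
  length and only finitely many values occur, and the all-empty schedule is feasible.
\<close>

definition opt_mrmd :: "('d, 'r, 'l, 'x) mrmd_scheme \<Rightarrow> nat" where
  "opt_mrmd I = Max {total_reward I P |P. feasible I P}"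

definition opt_mrmdc :: "('d, 'r, 'l) mrmdc \<Rightarrow> int" where
  "opt_mrmdc I = Max {net_reward I P |P. feasible I P}"


section \<open>Algorithms, instance size and running time\<close>

text \<open>
  The numbers \<open>num I r s\<close> are encoded in binary, so the number of resources may be exponential in
  the size of the instance. Algorithms therefore output only the nonempty paths, as an
  association list.
\<close>

type_synonym ('d, 'r, 'l) plan = "(('r, 'l) resource \<times> 'd list) list"

definition schedule_of :: "('d, 'r, 'l) plan \<Rightarrow> ('d, 'r, 'l) schedule" where
  "schedule_of X = (\<lambda>\<rho>. case map_of X \<rho> of None \<Rightarrow> [] | Some p \<Rightarrow> p)"

definition feasible_plan :: "('d, 'r, 'l, 'x) mrmd_scheme \<Rightarrow> ('d, 'r, 'l) plan \<Rightarrow> bool" where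
  "feasible_plan I X \<longleftrightarrow>
     distinct (map fst X) \<and> fst ` set X \<subseteq> resources I \<and> [] \<notin> snd ` set X \<and>
     feasible I (schedule_of X)"

definition bits :: "nat \<Rightarrow> nat" where
  "bits n = max 1 (floorlog 2 n)"

definition mrmd_size :: "('d, 'r, 'l, 'x) mrmd_scheme \<Rightarrow> nat" where
  "mrmd_size I =
     (\<Sum>d\<leftarrow>demands I. 1 + length (req I d) +
        bits (start_time I d) + bits (duration I d) + bits (reward I d)) +
     (\<Sum>r\<leftarrow>types I. 1 + (\<Sum>s\<leftarrow>starts I r. 1 + bits (num I r s))) +
     (\<Sum>x\<in>locations I. \<Sum>y\<in>demand_locations I. bits (travel I x y))"

definition mrmdc_size :: "('d, 'r, 'l) mrmdc \<Rightarrow> nat" where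
  "mrmdc_size I =
     mrmd_size I + (\<Sum>x\<in>locations I. \<Sum>y\<in>demand_locations I. bits (cost I x y))"

definition polynomial_time_on :: "'i set \<Rightarrow> ('i \<Rightarrow> nat) \<Rightarrow> ('i \<Rightarrow> nat) \<Rightarrow> bool" where
  "polynomial_time_on \<I> size_of T \<longleftrightarrow> (\<exists>p :: nat poly. \<forall>I\<in>\<I>. T I \<le> poly p (size_of I))"

text \<open>\<open>alg\<close> is the algorithm and \<open>T\<close> the number of steps it takes on each instance.\<close>

definition approximation_algorithm ::
  "('d, 'r, 'l) mrmdc set \<Rightarrow> (('d, 'r, 'l) mrmdc \<Rightarrow> real) \<Rightarrow>
   (('d, 'r, 'l) mrmdc \<Rightarrow> ('d, 'r, 'l) plan) \<Rightarrow> (('d, 'r, 'l) mrmdc \<Rightarrow> nat) \<Rightarrow> bool" where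
  "approximation_algorithm \<I> \<alpha> alg T \<longleftrightarrow>
     (\<forall>I\<in>\<I>. feasible_plan I (alg I) \<and>
        real_of_int (net_reward I (schedule_of (alg I))) \<ge> 1 / \<alpha> I * real_of_int (opt_mrmdc I)) \<and>
     polynomial_time_on \<I> mrmdc_size T"

definition single_type_instances :: "('d, 'r, 'l) mrmd set" where
  "single_type_instances = {I. valid I \<and> triangle_inequality I \<and> length (types I) = 1}"

text \<open>
  The min-cost-flow subroutine: an optimal solution in which every demand is visited at most once.
\<close>

definition exact_single_type_algorithm ::
  "(('d, 'r, 'l) mrmd \<Rightarrow> ('d, 'r, 'l) plan) \<Rightarrow> (('d, 'r, 'l) mrmd \<Rightarrow> nat) \<Rightarrow> bool" where
  "exact_single_type_algorithm solve T \<longleftrightarrow>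
     (\<forall>I\<in>single_type_instances.
        feasible_plan I (solve I) \<and>
        total_reward I (schedule_of (solve I)) = opt_mrmd I \<and>
        (\<forall>d\<in>set (demands I). card {\<rho> \<in> resources I. d \<in> set (schedule_of (solve I) \<rho>)} \<le> 1)) \<and>
     polynomial_time_on single_type_instances mrmd_size T"


section \<open>The algorithm\<close>

definition num_resources :: "('d, 'r, 'l) mrmd \<Rightarrow> 'r \<Rightarrow> nat" where
  "num_resources I r = sum_list (map (num I r) (starts I r))"

definition restrict_to_type :: "('d, 'r, 'l) mrmd \<Rightarrow> 'r \<Rightarrow> 'd list \<Rightarrow> ('d, 'r, 'l) mrmd" where
  "restrict_to_type I r D = I\<lparr>demands := D, types := [r], req := (\<lambda>_. [r])\<rparr>"

text \<open>
  On a plan in which every demand is visited at most once this is the reward of the visited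
  demands.
\<close>

definition plan_value :: "('d, 'r, 'l) mrmd \<Rightarrow> ('d, 'r, 'l) plan \<Rightarrow> nat" where
  "plan_value I X = sum_list (map (reward I) (concat (map snd X)))"

text \<open>
  The \<open>k\<close>-th resource of type \<open>q\<close> follows the \<open>k\<close>-th scheduled resource, visiting the demands
  that require \<open>q\<close>.
\<close>

definition follow :: "('d, 'r, 'l) mrmd \<Rightarrow> ('d, 'r, 'l) plan \<Rightarrow> 'r \<Rightarrow> ('d, 'r, 'l) plan" where
  "follow I X q =
     filter (\<lambda>(\<rho>, p). p \<noteq> [])
       (map (\<lambda>((r, s, k), p). ((q, s, k), filter (\<lambda>d. q \<in> set (req I d)) p)) X)"

text \<open>
  In round \<open>r\<close> the current demands do not require any type of an earlier round, so only \<open>r\<close> and the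
  types \<open>rs\<close> of the later rounds take part.
\<close>

fun rounds ::
  "(('d, 'r, 'l) mrmd \<Rightarrow> ('d, 'r, 'l) plan) \<Rightarrow> ('d, 'r, 'l) mrmd \<Rightarrow> 'r list \<Rightarrow> 'd list \<Rightarrow>
   nat \<times> ('d, 'r, 'l) plan \<Rightarrow> nat \<times> ('d, 'r, 'l) plan" where
  "rounds solve I [] D best = best"
| "rounds solve I (r # rs) D best =
     (let X = solve (restrict_to_type I r (filter (\<lambda>d. r \<in> set (req I d)) D));
          v = plan_value I X
      in rounds solve I rs (filter (\<lambda>d. r \<notin> set (req I d)) D)
           (if v \<ge> fst best then (v, concat (map (follow I X) (r # rs))) else best))"

definition algorithm_A ::
  "(('d, 'r, 'l) mrmd \<Rightarrow> ('d, 'r, 'l) plan) \<Rightarrow> ('d, 'r, 'l) mrmd \<Rightarrow> nat \<times> ('d, 'r, 'l) plan" where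
  "algorithm_A solve I =
     rounds solve I (sort_key (num_resources I) (types I)) (demands I) (0, [])"


section \<open>Running time of the algorithm\<close>

text \<open>
  Steps are counted by the translation of \<open>HOL-Library.Time_Functions\<close>: one step per function call,
  while constructors, comparisons, additions and table look-ups are absorbed in the calls.
  The subroutine comes with its own step count \<open>T_solve\<close>, and writing down its input is charged
  separately.
\<close>

fun T_member :: "'a \<Rightarrow> 'a list \<Rightarrow> nat" where
  "T_member x [] = 1"
| "T_member x (y # ys) = (if x = y then 0 else T_member x ys) + 1"

fun T_sum_list :: "nat list \<Rightarrow> nat" where
  "T_sum_list [] = 1"
| "T_sum_list (x # xs) = T_sum_list xs + 1"

fun T_concat :: "'a list list \<Rightarrow> nat" where
  "T_concat [] = 1"
| "T_concat (xs # xss) = T_concat xss + T_append xs (concat xss) + 1"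

fun T_insort_key :: "('a \<Rightarrow> nat) \<Rightarrow> ('a \<Rightarrow> nat) \<Rightarrow> 'a \<Rightarrow> 'a list \<Rightarrow> nat" where
  "T_insort_key f T_f x [] = 1"
| "T_insort_key f T_f x (y # ys) =
     T_f x + T_f y + (if f x \<le> f y then 0 else T_insort_key f T_f x ys) + 1"

fun T_sort_key :: "('a \<Rightarrow> nat) \<Rightarrow> ('a \<Rightarrow> nat) \<Rightarrow> 'a list \<Rightarrow> nat" where
  "T_sort_key f T_f [] = 1"
| "T_sort_key f T_f (x # xs) =
     T_sort_key f T_f xs + T_insort_key f T_f x (sort_key f xs) + 1"

definition T_num_resources :: "('d, 'r, 'l) mrmd \<Rightarrow> 'r \<Rightarrow> nat" where
  "T_num_resources I r =
     T_map (\<lambda>_. 0) (starts I r) + T_sum_list (map (num I r) (starts I r)) + 1"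

definition T_plan_value :: "('d, 'r, 'l) mrmd \<Rightarrow> ('d, 'r, 'l) plan \<Rightarrow> nat" where
  "T_plan_value I X =
     T_map T_snd X + T_concat (map snd X) + T_map (\<lambda>_. 0) (concat (map snd X)) +
     T_sum_list (map (reward I) (concat (map snd X))) + 1"

definition T_follow :: "('d, 'r, 'l) mrmd \<Rightarrow> ('d, 'r, 'l) plan \<Rightarrow> 'r \<Rightarrow> nat" where
  "T_follow I X q =
     T_map (\<lambda>(\<rho>, p). T_filter (\<lambda>d. T_member q (req I d)) p) X +
     T_filter (\<lambda>_. 0)
       (map (\<lambda>((r, s, k), p). ((q, s, k), filter (\<lambda>d. q \<in> set (req I d)) p)) X) + 1"

fun T_rounds ::
  "(('d, 'r, 'l) mrmd \<Rightarrow> ('d, 'r, 'l) plan) \<Rightarrow> (('d, 'r, 'l) mrmd \<Rightarrow> nat) \<Rightarrow>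
   ('d, 'r, 'l) mrmd \<Rightarrow> 'r list \<Rightarrow> 'd list \<Rightarrow> nat \<times> ('d, 'r, 'l) plan \<Rightarrow> nat" where
  "T_rounds solve T_solve I [] D best = 1"
| "T_rounds solve T_solve I (r # rs) D best =
     (let J = restrict_to_type I r (filter (\<lambda>d. r \<in> set (req I d)) D);
          X = solve J;
          v = plan_value I X
      in T_filter (\<lambda>d. T_member r (req I d)) D + mrmd_size J + T_solve J + T_plan_value I X +
         T_filter (\<lambda>d. T_member r (req I d)) D + T_fst best +
         (if v \<ge> fst best
          then T_map (T_follow I X) (r # rs) + T_concat (map (follow I X) (r # rs)) else 0) +
         T_rounds solve T_solve I rs (filter (\<lambda>d. r \<notin> set (req I d)) D)
           (if v \<ge> fst best then (v, concat (map (follow I X) (r # rs))) else best) + 1)"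

definition T_algorithm_A ::
  "(('d, 'r, 'l) mrmd \<Rightarrow> ('d, 'r, 'l) plan) \<Rightarrow> (('d, 'r, 'l) mrmd \<Rightarrow> nat) \<Rightarrow>
   ('d, 'r, 'l) mrmd \<Rightarrow> nat" where
  "T_algorithm_A solve T_solve I =
     T_sort_key (num_resources I) (T_num_resources I) (types I) +
     T_rounds solve T_solve I (sort_key (num_resources I) (types I)) (demands I) (0, []) + 1"

end

theory Submission
  imports Defs "HOL-Library.FuncSet"
begin

text \<open>
  By the triangle inequality a resource may skip demands of its path, so the paths of a feasible
  schedule, cut down to the demands that leave the current set in round \<open>r\<close>, are feasible for
  \<open>1R1D\<^sup>r\<close>. Every met demand leaves in exactly one round, hence the best of the \<open>|R|\<close> round optima
  is at least \<open>1/|R|\<close> times the optimal reward. In round \<open>r\<close> all remaining types have at least \<open>m\<^sub>r\<close>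
  resources, and since these start at the same location they can follow the schedules of the
  type-\<open>r\<close> resources. Each demand served in this way causes at most \<open>|R|\<close> trips, each of cost at
  most \<open>w\<^sup>m\<^sup>i\<^sup>n/(2|R|)\<close>, so travel consumes at most half of the collected reward.
\<close>

section \<open>Paths and plans\<close>

text \<open>\<open>t\<close> is the time at which the resource is ready to leave \<open>x\<close>.\<close>

fun on_time ::
  "('d, 'r, 'l, 'x) mrmd_scheme \<Rightarrow> 'l \<Rightarrow> nat \<Rightarrow> 'd list \<Rightarrow> bool" where
  "on_time I x t [] = True"
| "on_time I x t (d # ds) \<longleftrightarrow>
     t + travel I x (dloc I d) \<le> start_time I d \<and>
     on_time I (dloc I d) (start_time I d + duration I d) ds"

text \<open>Separates the two conditions in \<open>serves_next\<close>: which types the demands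
  require, and whether the time windows chain. The second does not mention the type, so it survives
  when a resource of another type follows the same path.\<close>

lemma successively_serves_next:
  "r \<in> set (req I d) \<Longrightarrow>
   successively (serves_next I r) (d # p) \<longleftrightarrow>
   (\<forall>e\<in>set p. r \<in> set (req I e)) \<and> on_time I (dloc I d) (start_time I d + duration I d) p"
proof (induction p arbitrary: d)
  case (Cons e p)
  then show ?case
    by (cases "r \<in> set (req I e)") (auto simp: serves_next_def)
qed simp

text \<open>Readiness at time 0 turns \<open>serves_first\<close> into one more link of the time
  chain, so the first trip needs no separate treatment later.\<close>

lemma is_path_iff:
  "is_path I (r, s, k) p \<longleftrightarrow>
   set p \<subseteq> {d \<in> set (demands I). r \<in> set (req I d)} \<and> on_time I s 0 p"
proof (cases p)
  case (Cons d p')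
  then show ?thesis
    by (cases "r \<in> set (req I d)")
      (auto simp: is_path_def serves_first_def successively_serves_next)
qed (simp add: is_path_def)

text \<open>Only the first trip of \<open>ds\<close> changes. By the triangle inequality the direct
  trip takes no longer than the one through \<open>y\<close>, and all later trips start from a
  demand of \<open>ds\<close>.\<close>

lemma on_time_detour:
  assumes "triangle_inequality I" "x \<in> locations I" "y \<in> demand_locations I"
    and "set ds \<subseteq> set (demands I)" "t + travel I x y \<le> t'" "on_time I y t' ds"
  shows "on_time I x t ds"
proof (cases ds)
  case (Cons d ds')
  have "dloc I d \<in> demand_locations I"
    using assms(4) Cons by (auto simp: demand_locations_def)
  then have "travel I x (dloc I d) \<le> travel I x y + travel I y (dloc I d)"
    using assms(1-3) by (auto simp: triangle_inequality_def)
  then show ?thesis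
    using assms(5,6) Cons by auto
qed simp

lemma on_time_filter:
  assumes "triangle_inequality I"
  shows "x \<in> locations I \<Longrightarrow> set p \<subseteq> set (demands I) \<Longrightarrow> on_time I x t p \<Longrightarrow>
    on_time I x t (filter Q p)"
proof (induction p arbitrary: x t)
  case (Cons d p)
  have d: "dloc I d \<in> demand_locations I" "dloc I d \<in> locations I"
    using Cons.prems(2) by (auto simp: demand_locations_def locations_def)
  have tail: "on_time I (dloc I d) (start_time I d + duration I d) (filter Q p)"
    using Cons.IH[OF d(2)] Cons.prems by auto
  show ?case
  proof (cases "Q d")
    case False
    \<comment> \<open>The dropped demand is the detour point: the resource would have been ready
      there only at \<open>start_time I d + duration I d\<close>, which is no earlier than its
      arrival.\<close>
    have "on_time I x t (filter Q p)"
      by (rule on_time_detour[OF assms Cons.prems(1) d(1) _ _ tail]) (use Cons.prems in auto)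
    then show ?thesis using False by simp
  qed (use tail Cons.prems in auto)
qed simp

lemma on_time_start_time:
  "on_time I x t p \<Longrightarrow> d \<in> set p \<Longrightarrow> t \<le> start_time I d"
  by (induction p arbitrary: x t) force+

text \<open>Positive durations make start times strictly increase along a path, so no demand
  recurs.\<close>

lemma on_time_distinct:
  "on_time I x t p \<Longrightarrow> \<forall>d\<in>set p. duration I d > 0 \<Longrightarrow> distinct p"
proof (induction p arbitrary: x t)
  case (Cons d p)
  have "d \<notin> set p"
  proof
    assume "d \<in> set p"
    with Cons.prems(1) on_time_start_time[of I _ "start_time I d + duration I d" p d]
    have "start_time I d + duration I d \<le> start_time I d" by auto
    then show False using Cons.prems(2) by simp
  qed
  then show ?case using Cons by auto
qed simp

lemma is_path_distinct:
  assumes "valid I" "is_path I \<rho> p"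
  shows "distinct p"
proof -
  obtain r s k where \<rho>: "\<rho> = (r, s, k)" by (cases \<rho>)
  show ?thesis
    using assms unfolding \<rho> is_path_iff
    by (intro on_time_distinct[of I s 0]) (auto simp: valid_def)
qed

lemma finite_resources: "finite (resources I)"
proof -
  have "resources I \<subseteq> (SIGMA r:set (types I). SIGMA s:set (starts I r). {..<num I r s})"
    by (auto simp: resources_def)
  then show ?thesis by (rule finite_subset) simp
qed

lemma resources_locations:
  "(r, s, k) \<in> resources I \<Longrightarrow> s \<in> locations I"
  by (auto simp: resources_def locations_def)

section \<open>Plans and the schedules they encode\<close>

lemma schedule_of_eq:
  "distinct (map fst X) \<Longrightarrow> (\<rho>, p) \<in> set X \<Longrightarrow> schedule_of X \<rho> = p"
  by (simp add: schedule_of_def)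

lemma schedule_of_in:
  "d \<in> set (schedule_of X \<rho>) \<Longrightarrow> (\<rho>, schedule_of X \<rho>) \<in> set X"
  by (auto simp: schedule_of_def split: option.splits dest: map_of_SomeD)

text \<open>Unlisted resources get the empty path, which is always allowed. Feasibility thus becomes
  a condition on the finitely many entries of the plan.\<close>

lemma feasible_plan_iff:
  "feasible_plan I X \<longleftrightarrow>
     distinct (map fst X) \<and> (\<forall>(\<rho>, p)\<in>set X. \<rho> \<in> resources I \<and> p \<noteq> [] \<and> is_path I \<rho> p)"
proof (cases "distinct (map fst X)")
  case True
  have "is_path I \<rho> (schedule_of X \<rho>)"
    if *: "\<forall>(\<rho>, p)\<in>set X. \<rho> \<in> resources I \<and> p \<noteq> [] \<and> is_path I \<rho> p" for \<rho>
  proof (cases "schedule_of X \<rho> = []")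
    case True
    then show ?thesis by (cases \<rho>) (simp add: is_path_iff)
  next
    case False
    then have "(\<rho>, schedule_of X \<rho>) \<in> set X"
      by (intro schedule_of_in[of "hd (schedule_of X \<rho>)"]) simp
    then show ?thesis using * by auto
  qed
  then have "feasible I (schedule_of X)"
    if "\<forall>(\<rho>, p)\<in>set X. \<rho> \<in> resources I \<and> p \<noteq> [] \<and> is_path I \<rho> p"
    using that by (auto simp: feasible_def)
  moreover have "\<rho> \<in> resources I \<and> p \<noteq> [] \<and> is_path I \<rho> p"
    if X: "feasible_plan I X" and p: "(\<rho>, p) \<in> set X" for \<rho> p
  proof -
    have "\<rho> \<in> fst ` set X" "p \<in> snd ` set X" using p by force+
    then show ?thesis
      using X schedule_of_eq[OF True p] unfolding feasible_plan_def feasible_def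
      by (metis (no_types, lifting) subsetD)
  qed
  moreover have "fst ` set X \<subseteq> resources I \<and> [] \<notin> snd ` set X"
    if "\<forall>(\<rho>, p)\<in>set X. \<rho> \<in> resources I \<and> p \<noteq> [] \<and> is_path I \<rho> p"
    using that by fastforce
  ultimately show ?thesis
    using True unfolding feasible_plan_def[of I X] by blast
qed (simp add: feasible_plan_def)

lemma met_schedule_of:
  assumes "distinct (map fst X)" "d \<in> set (demands I)"
    and "\<And>r. r \<in> set (req I d) \<Longrightarrow>
      \<exists>s k p. (r, s, k) \<in> resources I \<and> ((r, s, k), p) \<in> set X \<and> d \<in> set p"
  shows "d \<in> met I (schedule_of X)"
  unfolding met_def
proof (intro CollectI conjI ballI assms(2))
  fix r assume "r \<in> set (req I d)"
  then obtain s k p where "(r, s, k) \<in> resources I" "((r, s, k), p) \<in> set X" "d \<in> set p"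
    using assms(3) by blast
  then show "\<exists>\<rho>\<in>resources I. fst \<rho> = r \<and> d \<in> set (schedule_of X \<rho>)"
    by (intro bexI[of _ "(r, s, k)"]) (auto simp: schedule_of_eq[OF assms(1)])
qed

lemma finite_met: "finite (met I P)"
  by (simp add: met_def)

text \<open>\<open>Max\<close> gives an upper bound only on a finite set; here all values are
  naturals bounded by the sum of all rewards.\<close>

lemma total_reward_le_opt_mrmd:
  assumes "feasible I P"
  shows "total_reward I P \<le> opt_mrmd I"
proof -
  have "total_reward I P' \<le> sum (reward I) (set (demands I))" for P'
    unfolding total_reward_def by (rule sum_mono2) (auto simp: met_def)
  then have "finite {total_reward I P' |P'. feasible I P'}"
    by (auto intro: finite_subset[OF _ finite_atMost[of "sum (reward I) (set (demands I))"]])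
  then show ?thesis
    unfolding opt_mrmd_def using assms by (intro Max_ge) auto
qed

section \<open>One round\<close>

lemma restrict_to_type_simps [simp]:
  "demands (restrict_to_type I r D) = D"
  "types (restrict_to_type I r D) = [r]"
  "req (restrict_to_type I r D) d = [r]"
  "starts (restrict_to_type I r D) = starts I"
  "num (restrict_to_type I r D) = num I"
  "start_time (restrict_to_type I r D) = start_time I"
  "duration (restrict_to_type I r D) = duration I"
  "reward (restrict_to_type I r D) = reward I"
  "dloc (restrict_to_type I r D) = dloc I"
  "travel (restrict_to_type I r D) = travel I"
  by (simp_all add: restrict_to_type_def)

lemma on_time_restrict_to_type [simp]:
  "on_time (restrict_to_type I r D) x t p = on_time I x t p"
  by (induction p arbitrary: x t) auto

lemma resources_restrict_to_type:
  assumes "r \<in> set (types I)"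
  shows "resources (restrict_to_type I r D) = {\<rho> \<in> resources I. fst \<rho> = r}"
  using assms by (auto simp: resources_def)

lemma demand_locations_restrict_to_type:
  "set D \<subseteq> set (demands I) \<Longrightarrow>
   demand_locations (restrict_to_type I r D) \<subseteq> demand_locations I"
  by (auto simp: demand_locations_def)

lemma locations_restrict_to_type:
  "r \<in> set (types I) \<Longrightarrow> set D \<subseteq> set (demands I) \<Longrightarrow>
   locations (restrict_to_type I r D) \<subseteq> locations I"
  using demand_locations_restrict_to_type[of D I r] by (auto simp: locations_def)

text \<open>Makes the guarantee for \<open>solve\<close> applicable. The triangle inequality is
  inherited because restriction only removes locations.\<close>

lemma restrict_to_type_single_type:
  assumes "valid I" "triangle_inequality I" "r \<in> set (types I)"
    and "distinct D" "set D \<subseteq> set (demands I)"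
  shows "restrict_to_type I r D \<in> single_type_instances"
  using assms demand_locations_restrict_to_type[OF assms(5), of r]
    locations_restrict_to_type[OF assms(3,5)]
  unfolding single_type_instances_def valid_def triangle_inequality_def by auto blast

text \<open>Since each demand is visited at most once and paths have no repetitions, the
  concatenated paths list the visited demands without duplicates. With a single required type,
  visited and met are the same, so the computed value is the optimum.\<close>

lemma solve_round:
  fixes I :: "('d, 'r, 'l) mrmd"
  assumes exact: "exact_single_type_algorithm solve T_solve"
    and I: "valid I" "triangle_inequality I" and r: "r \<in> set (types I)"
    and D: "distinct D" "set D \<subseteq> set (demands I)"
    and X: "X = solve (restrict_to_type I r D)"
  shows "feasible_plan (restrict_to_type I r D) X"
    and "distinct (concat (map snd X))"
    and "set (concat (map snd X)) \<subseteq> set D"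
    and "plan_value I X = sum (reward I) (set (concat (map snd X)))"
    and "plan_value I X = opt_mrmd (restrict_to_type I r D)"
proof -
  define J where "J = restrict_to_type I r D"
  have J: "J \<in> single_type_instances"
    unfolding J_def using assms by (intro restrict_to_type_single_type)
  then have vJ: "valid J" by (simp add: single_type_instances_def)
  have feas: "feasible_plan J X"
    and opt: "total_reward J (schedule_of X) = opt_mrmd J"
    and once: "\<forall>d\<in>set (demands J). card {\<rho> \<in> resources J. d \<in> set (schedule_of X \<rho>)} \<le> 1"
    using exact J X by (auto simp: exact_single_type_algorithm_def J_def)
  then show "feasible_plan (restrict_to_type I r D) X" by (simp add: J_def)
  have dist: "distinct (map fst X)"
    and paths: "\<And>\<rho> p. (\<rho>, p) \<in> set X \<Longrightarrow> \<rho> \<in> resources J \<and> p \<noteq> [] \<and> is_path J \<rho> p"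
    using feas by (auto simp: feasible_plan_iff)
  have sub: "set p \<subseteq> set D" if "(\<rho>, p) \<in> set X" for \<rho> p
    using paths[OF that] by (cases \<rho>) (auto simp: is_path_iff J_def)
  then show sub': "set (concat (map snd X)) \<subseteq> set D" by fastforce
  \<comment> \<open>Both resources lie in the set of visitors of \<open>d\<close>, which has at most
    one element.\<close>
  have disj: "\<rho> = \<rho>'" if "(\<rho>, p) \<in> set X" "(\<rho>', p') \<in> set X" "d \<in> set p" "d \<in> set p'"
    for \<rho> \<rho>' p p' d
  proof -
    let ?S = "{\<rho> \<in> resources J. d \<in> set (schedule_of X \<rho>)}"
    have "card ?S \<le> 1"
      using once sub[OF that(1)] that(3) by (simp add: J_def subset_eq)
    moreover have "\<rho> \<in> ?S" "\<rho>' \<in> ?S"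
      using that paths schedule_of_eq[OF dist] by auto
    ultimately show ?thesis
      by (intro card_le_Suc0_iff_eq[THEN iffD1, rule_format, of ?S])
        (simp_all add: finite_resources)
  qed
  show dist': "distinct (concat (map snd X))"
  proof -
    \<comment> \<open>Listed paths are nonempty, so equal paths would share their first demand and
      hence, by \<open>disj\<close>, belong to the same resource.\<close>
    have "distinct (map snd X)"
      unfolding distinct_map
    proof (intro conjI inj_onI)
      show "distinct X" using dist by (simp add: distinct_map)
      fix a b assume ab: "a \<in> set X" "b \<in> set X" "snd a = snd b"
      then have "hd (snd a) \<in> set (snd a)" using paths[of "fst b" "snd b"] by simp
      moreover have "(fst a, snd b) \<in> set X" "(fst b, snd b) \<in> set X"
        using ab by (metis prod.collapse)+
      ultimately have "fst a = fst b" using ab(3) disj by metis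
      then show "a = b" using ab by (simp add: prod_eq_iff)
    qed
    moreover have "distinct p" if "p \<in> set (map snd X)" for p
    proof -
      from that obtain \<rho> where "(\<rho>, p) \<in> set X" by auto
      with paths show ?thesis by (intro is_path_distinct[OF vJ, of \<rho>]) blast
    qed
    moreover have "set p \<inter> set p' = {}"
      if "p \<in> set (map snd X)" "p' \<in> set (map snd X)" "p \<noteq> p'" for p p'
    proof (rule ccontr)
      assume "set p \<inter> set p' \<noteq> {}"
      then obtain d where d: "d \<in> set p" "d \<in> set p'" by auto
      from that obtain \<rho> \<rho>' where "(\<rho>, p) \<in> set X" "(\<rho>', p') \<in> set X" by auto
      with disj[OF this d] that(3) schedule_of_eq[OF dist] show False by metis
    qed
    ultimately show ?thesis by (rule distinct_concat)
  qed
  show val: "plan_value I X = sum (reward I) (set (concat (map snd X)))"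
    unfolding plan_value_def using dist' by (rule sum_list_distinct_conv_sum_set)
  have "met J (schedule_of X) = set (concat (map snd X))"
  proof (intro equalityI subsetI)
    fix d assume "d \<in> met J (schedule_of X)"
    then obtain \<rho> where "d \<in> set (schedule_of X \<rho>)"
      by (auto simp: met_def J_def)
    from schedule_of_in[OF this] this show "d \<in> set (concat (map snd X))" by force
  next
    fix d assume "d \<in> set (concat (map snd X))"
    then obtain \<rho> p where p: "(\<rho>, p) \<in> set X" "d \<in> set p" by auto
    with paths have "\<rho> \<in> resources J" by auto
    then have "fst \<rho> = r" by (auto simp: resources_def J_def)
    with p paths[OF p(1)] sub[OF p(1)] show "d \<in> met J (schedule_of X)"
      by (intro met_schedule_of[OF dist]) (cases \<rho>; auto simp: J_def)+
  qed
  then show "plan_value I X = opt_mrmd (restrict_to_type I r D)"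
    using opt val by (simp add: total_reward_def J_def)
qed

lemma feasible_restrict_to_type:
  assumes I: "valid I" "triangle_inequality I" and r: "r \<in> set (types I)"
    and D: "set D \<subseteq> set (demands I)" and P: "feasible I P"
  shows "feasible (restrict_to_type I r D) (\<lambda>\<rho>. filter (\<lambda>d. d \<in> set D) (P \<rho>))"
  unfolding feasible_def
proof
  fix \<rho> assume "\<rho> \<in> resources (restrict_to_type I r D)"
  then obtain s k where \<rho>: "\<rho> = (r, s, k)" "\<rho> \<in> resources I"
    using r by (cases \<rho>) (auto simp: resources_restrict_to_type)
  then have "is_path I (r, s, k) (P \<rho>)" using P by (auto simp: feasible_def)
  then show "is_path (restrict_to_type I r D) \<rho> (filter (\<lambda>d. d \<in> set D) (P \<rho>))"
    using on_time_filter[OF I(2), of s "P \<rho>" 0] resources_locations[of r s k I] \<rho>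
    by (auto simp: is_path_iff)
qed

text \<open>The paths of \<open>P\<close> cut down to \<open>D\<close> are a feasible solution of
  the round's problem. A demand of \<open>D\<close> met by \<open>P\<close> is visited by some
  resource of type \<open>r\<close>, which is all that the restricted problem asks for.\<close>

lemma met_reward_le_opt_round:
  assumes I: "valid I" "triangle_inequality I" and r: "r \<in> set (types I)"
    and D: "set D \<subseteq> set (demands I)" "\<And>d. d \<in> set D \<Longrightarrow> r \<in> set (req I d)"
    and P: "feasible I P"
  shows "sum (reward I) (set D \<inter> met I P) \<le> opt_mrmd (restrict_to_type I r D)"
proof -
  let ?J = "restrict_to_type I r D" and ?P = "\<lambda>\<rho>. filter (\<lambda>d. d \<in> set D) (P \<rho>)"
  have "set D \<inter> met I P \<subseteq> met ?J ?P"
    using D r by (fastforce simp: met_def resources_restrict_to_type)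
  then have "sum (reward I) (set D \<inter> met I P) \<le> sum (reward I) (met ?J ?P)"
    by (intro sum_mono2) (auto simp: finite_met)
  also have "\<dots> = total_reward ?J ?P" by (simp add: total_reward_def)
  also have "\<dots> \<le> opt_mrmd ?J"
    by (intro total_reward_le_opt_mrmd feasible_restrict_to_type assms)
  finally show ?thesis .
qed

section \<open>Completing a schedule to all types\<close>

text \<open>All resources of type \<open>q\<close> start at \<open>s\<close>, so
  \<open>num I q s\<close> is their total number, and \<open>k\<close> is below it because type
  \<open>q\<close> has at least as many resources as type \<open>r\<close>. Hence the
  \<open>k\<close>-th resource of type \<open>q\<close> can shadow the \<open>k\<close>-th of type
  \<open>r\<close>.\<close>

lemma same_start_resource:
  fixes I :: "('d, 'r, 'l) mrmd"
  assumes I: "valid I" "same_start I"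
    and \<rho>: "(r, s, k) \<in> resources I" and q: "q \<in> set (types I)"
    and le: "num_resources I r \<le> num_resources I q"
  shows "(q, s, k) \<in> resources I"
proof -
  have r: "r \<in> set (types I)" "s \<in> set (starts I r)" "k < num I r s"
    using \<rho> by (auto simp: resources_def)
  have same: "s' = s" if "(q, s', k') \<in> resources I" for s' k'
  proof -
    obtain s0 where "\<And>\<rho>. \<rho> \<in> resources I \<Longrightarrow> fst (snd \<rho>) = s0"
      using I(2) unfolding same_start_def by fastforce
    from this[OF \<rho>] this[OF that] show ?thesis by simp
  qed
  have "num I r s \<le> num_resources I r"
    unfolding num_resources_def by (rule member_le_sum_list) (use r in auto)
  with r le have k: "k < num_resources I q" by simp
  also have nq: "num_resources I q = sum (num I q) (set (starts I q))"
    unfolding num_resources_def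
    by (rule sum_list_distinct_conv_sum_set) (use I(1) q in \<open>auto simp: valid_def\<close>)
  \<comment> \<open>Some listed start of \<open>q\<close> therefore holds a resource, and a common
    start forces it to be \<open>s\<close>; this is what puts \<open>s\<close> into
    \<open>starts I q\<close>.\<close>
  finally have "sum (num I q) (set (starts I q)) > 0" by simp
  then obtain s' where s': "s' \<in> set (starts I q)" "num I q s' > 0"
    by (metis (no_types) gr0I sum.neutral less_irrefl)
  then have "s' = s" using q by (intro same[of s' 0]) (auto simp: resources_def)
  \<comment> \<open>Other starting locations may be listed, but they hold no resources and drop out
    of the sum.\<close>
  have "num I q x = 0" if "x \<in> set (starts I q) - {s}" for x
    using that q same[of x 0] by (auto simp: resources_def)
  then have "sum (num I q) (set (starts I q)) = sum (num I q) {s}"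
    using s' \<open>s' = s\<close> by (intro sum.mono_neutral_right) auto
  then show ?thesis
    using k nq s' \<open>s' = s\<close> q by (auto simp: resources_def)
qed

section \<open>The plans of the following resources\<close>

lemma set_follow:
  "set (follow I X q) =
     {((q, s, k), filter (\<lambda>d. q \<in> set (req I d)) p) |r s k p.
        ((r, s, k), p) \<in> set X \<and> filter (\<lambda>d. q \<in> set (req I d)) p \<noteq> []}"
  unfolding follow_def by force

text \<open>Writes the keys as an image of a sublist of \<open>X\<close>, so that their distinctness
  reduces to injectivity of changing the type.\<close>

lemma fst_follow:
  "map fst (follow I X q) =
     map (\<lambda>((r, s, k), p). (q, s, k))
       (filter (\<lambda>(\<rho>, p). filter (\<lambda>d. q \<in> set (req I d)) p \<noteq> []) X)"
  by (induction X) (auto simp: follow_def)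

lemma length_concat_follow:
  "length (concat (map snd (follow I X q))) \<le> length (concat (map snd X))"
  by (induction X) (auto simp: follow_def intro: add_mono)

text \<open>
  \<open>V\<close> is a set of met demands that earns the recorded value; each of its demands pays for at most
  \<open>|R|\<close> trips.
\<close>

definition good_result ::
  "('d, 'r, 'l) mrmd \<Rightarrow> nat \<times> ('d, 'r, 'l) plan \<Rightarrow> bool" where
  "good_result I = (\<lambda>(v, Y). feasible_plan I Y \<and>
     (\<exists>V. V \<subseteq> met I (schedule_of Y) \<and> v = sum (reward I) V \<and>
        length (concat (map snd Y)) \<le> length (types I) * card V))"

text \<open>The witness \<open>V\<close> is the set of demands visited by \<open>X\<close>.
  Followers exist by \<open>same_start_resource\<close> and stay on time by
  \<open>on_time_filter\<close>. Every type required by a demand of \<open>D\<close> is in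
  \<open>r # rs\<close>, so each visited demand is met. One trip per visited demand and type gives
  the bound on the number of trips.\<close>

lemma good_result_round:
  fixes I :: "('d, 'r, 'l) mrmd"
  assumes exact: "exact_single_type_algorithm solve T_solve"
    and I: "valid I" "triangle_inequality I" "same_start I"
    and rs: "distinct (r # rs)" "set (r # rs) \<subseteq> set (types I)"
      "\<And>q. q \<in> set rs \<Longrightarrow> num_resources I r \<le> num_resources I q"
    and D: "distinct D" "set D \<subseteq> set (demands I)"
      "\<And>d. d \<in> set D \<Longrightarrow> r \<in> set (req I d) \<and> set (req I d) \<subseteq> set (r # rs)"
    and X: "X = solve (restrict_to_type I r D)"
  shows "good_result I (plan_value I X, concat (map (follow I X) (r # rs)))"
proof -
  let ?Y = "concat (map (follow I X) (r # rs))" and ?V = "set (concat (map snd X))"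
  have r: "r \<in> set (types I)" using rs by simp
  note round = solve_round[OF exact I(1,2) r D(1,2) X]
  have distX: "distinct (map fst X)"
    and paths: "\<And>\<rho> p. (\<rho>, p) \<in> set X \<Longrightarrow> \<rho> \<in> resources (restrict_to_type I r D) \<and>
      p \<noteq> [] \<and> is_path (restrict_to_type I r D) \<rho> p"
    using round(1) by (auto simp: feasible_plan_iff)
  have path: "q' = r" "(r, s, k) \<in> resources I" "set p \<subseteq> set D" "on_time I s 0 p"
    if "((q', s, k), p) \<in> set X" for q' s k p
    using paths[OF that] r by (auto simp: resources_restrict_to_type is_path_iff)
  have res: "(q, s, k) \<in> resources I" if "(r, s, k) \<in> resources I" "q \<in> set (r # rs)" for q s k
    using same_start_resource[OF I(1,3) that(1), of q] rs that by auto
  have dist1: "distinct (map fst (follow I X q))" for q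
  proof -
    \<comment> \<open>All keys of \<open>X\<close> carry the same type \<open>r\<close>, so
      replacing it by \<open>q\<close> loses no information.\<close>
    have "inj_on (\<lambda>((r, s, k), p). (q, s, k)) (set X)"
    proof (rule inj_onI)
      fix a b
      assume ab: "a \<in> set X" "b \<in> set X"
        "(\<lambda>((r, s, k), p). (q, s, k)) a = (\<lambda>((r, s, k), p). (q, s, k)) b"
      moreover obtain r1 s k p where a: "a = ((r1, s, k), p)" by (metis prod.exhaust)
      moreover obtain r2 s' k' p' where b: "b = ((r2, s', k'), p')" by (metis prod.exhaust)
      ultimately have "s = s'" "k = k'" "r1 = r" "r2 = r"
        using path(1)[of r1 s k p] path(1)[of r2 s' k' p'] by auto
      then have "fst a = fst b" using a b by simp
      with distX ab(1,2) show "a = b" by (simp add: distinct_map inj_on_def)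
    qed
    then show ?thesis
      using distX unfolding fst_follow distinct_map
      by (simp add: inj_on_subset[of _ "set X"])
  qed
  have distY: "distinct (map fst ?Y)"
  proof -
    have "distinct (map fst (concat (map (follow I X) qs)))" if "distinct qs" for qs
      using that by (induction qs) (auto simp: dist1 set_follow)
    then show ?thesis using rs(1) by blast
  qed
  have feas: "feasible_plan I ?Y"
    unfolding feasible_plan_iff
  proof (intro conjI ballI distY)
    fix z assume "z \<in> set ?Y"
    then obtain q q' s k p where q: "q \<in> set (r # rs)"
      and z: "z = ((q, s, k), filter (\<lambda>d. q \<in> set (req I d)) p)"
        "filter (\<lambda>d. q \<in> set (req I d)) p \<noteq> []"
      and p: "((q', s, k), p) \<in> set X"
      by (auto simp: set_follow)
    have "(q, s, k) \<in> resources I" using path(2)[OF p] q by (rule res)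
    moreover have "on_time I s 0 (filter (\<lambda>d. q \<in> set (req I d)) p)"
      using path[OF p] D(2) resources_locations[of r s k I]
      by (intro on_time_filter[OF I(2)]) auto
    ultimately show "case z of (\<rho>, p) \<Rightarrow> \<rho> \<in> resources I \<and> p \<noteq> [] \<and> is_path I \<rho> p"
      using z path(3)[OF p] D(2) by (auto simp: is_path_iff)
  qed
  have met: "?V \<subseteq> met I (schedule_of ?Y)"
  proof
    fix d assume "d \<in> ?V"
    then obtain q' s k p where p: "((q', s, k), p) \<in> set X" "d \<in> set p" by auto
    have d: "d \<in> set D" using path(3)[OF p(1)] p(2) by auto
    show "d \<in> met I (schedule_of ?Y)"
    proof (rule met_schedule_of[OF distY])
      show "d \<in> set (demands I)" using d D(2) by auto
      fix q assume q: "q \<in> set (req I d)"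
      then have q': "q \<in> set (r # rs)" using D(3)[OF d] by auto
      have "((q, s, k), filter (\<lambda>d. q \<in> set (req I d)) p) \<in> set (follow I X q)"
        unfolding set_follow using p q by (auto simp: filter_empty_conv)
      then show "\<exists>s k p. (q, s, k) \<in> resources I \<and> ((q, s, k), p) \<in> set ?Y \<and> d \<in> set p"
        using res[OF path(2)[OF p(1)] q'] q' p(2) q
        by (intro exI[of _ s] exI[of _ k] exI[of _ "filter (\<lambda>d. q \<in> set (req I d)) p"]) auto
    qed
  qed
  \<comment> \<open>Resources of one type together make at most as many trips as there are visits in
    \<open>X\<close>.\<close>
  have "length (concat (map snd (concat (map (follow I X) qs)))) \<le>
      length qs * length (concat (map snd X))" for qs
  proof (induction qs)
    case (Cons q qs)
    then show ?case using length_concat_follow[of I X q] by simp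
  qed simp
  from this[of "r # rs"] have "length (concat (map snd ?Y)) \<le> length (r # rs) * card ?V"
    using distinct_card[OF round(2)] by simp
  also have "length (r # rs) \<le> length (types I)"
    using rs(1,2) by (metis card_mono card_length distinct_card List.finite_set le_trans)
  finally have "length (concat (map snd ?Y)) \<le> length (types I) * card ?V" by simp
  then show ?thesis
    unfolding good_result_def using feas met round(4) by auto
qed

section \<open>All rounds\<close>

text \<open>Invariant: current demands require only types of the remaining rounds. Discarding the
  demands that require \<open>r\<close> preserves it, and the sorting supplies the comparison of
  resource numbers in each round.\<close>

lemma good_result_rounds:
  fixes I :: "('d, 'r, 'l) mrmd"
  assumes exact: "exact_single_type_algorithm solve T_solve"
    and I: "valid I" "triangle_inequality I" "same_start I"
  shows "distinct rs \<Longrightarrow> set rs \<subseteq> set (types I) \<Longrightarrow> sorted (map (num_resources I) rs) \<Longrightarrow>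
    distinct D \<Longrightarrow> set D \<subseteq> set (demands I) \<Longrightarrow> (\<forall>d\<in>set D. set (req I d) \<subseteq> set rs) \<Longrightarrow>
    good_result I best \<Longrightarrow> good_result I (rounds solve I rs D best)"
proof (induction rs arbitrary: D best)
  case (Cons r rs)
  let ?X = "solve (restrict_to_type I r (filter (\<lambda>d. r \<in> set (req I d)) D))"
  have "good_result I (plan_value I ?X, concat (map (follow I ?X) (r # rs)))"
    by (rule good_result_round[OF exact I]) (use Cons.prems in auto)
  moreover have "\<forall>d\<in>set (filter (\<lambda>d. r \<notin> set (req I d)) D). set (req I d) \<subseteq> set rs"
    using Cons.prems(6) by fastforce
  ultimately show ?case
    using Cons.prems unfolding rounds.simps Let_def by (intro Cons.IH) auto
qed simp

text \<open>The record never decreases, so the final value dominates the optimum of every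
  round.\<close>

lemma rounds_ge: "fst best \<le> fst (rounds solve I rs D best)"
proof (induction rs arbitrary: D best)
  case (Cons r rs)
  show ?case
    unfolding rounds.simps Let_def
    by (rule order_trans[OF _ Cons.IH]) auto
qed simp

text \<open>Each round is charged with the met demands it removes; their reward is at most the
  round's optimum and hence at most the final value, which is the same for all rounds.\<close>

lemma met_reward_le_rounds:
  fixes I :: "('d, 'r, 'l) mrmd"
  assumes exact: "exact_single_type_algorithm solve T_solve"
    and I: "valid I" "triangle_inequality I" and P: "feasible I P"
  shows "set rs \<subseteq> set (types I) \<Longrightarrow> distinct D \<Longrightarrow> set D \<subseteq> set (demands I) \<Longrightarrow>
    (\<forall>d\<in>set D. set (req I d) \<inter> set rs \<noteq> {}) \<Longrightarrow>
    sum (reward I) (set D \<inter> met I P) \<le> length rs * fst (rounds solve I rs D best)"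
proof (induction rs arbitrary: D best)
  case Nil
  \<comment> \<open>Every current demand requires a remaining type; with none left, all demands have
    been charged to some round.\<close>
  then have "D = []" by (cases D) auto
  then show ?case by simp
next
  case (Cons r rs)
  let ?D1 = "filter (\<lambda>d. r \<in> set (req I d)) D" and ?D2 = "filter (\<lambda>d. r \<notin> set (req I d)) D"
  let ?X = "solve (restrict_to_type I r ?D1)"
  define best' where "best' =
    (if plan_value I ?X \<ge> fst best
     then (plan_value I ?X, concat (map (follow I ?X) (r # rs))) else best)"
  define v where "v = fst (rounds solve I rs ?D2 best')"
  have v: "fst (rounds solve I (r # rs) D best) = v"
    by (simp add: v_def best'_def Let_def)
  have "sum (reward I) (set ?D1 \<inter> met I P) \<le> opt_mrmd (restrict_to_type I r ?D1)"
    by (rule met_reward_le_opt_round[OF I _ _ _ P]) (use Cons.prems in auto)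
  also have "\<dots> = plan_value I ?X"
    by (rule solve_round(5)[OF exact I, symmetric]) (use Cons.prems in auto)
  also have "\<dots> \<le> fst best'" by (simp add: best'_def)
  also have "\<dots> \<le> v" unfolding v_def by (rule rounds_ge)
  finally have 1: "sum (reward I) (set ?D1 \<inter> met I P) \<le> v" .
  have 2: "sum (reward I) (set ?D2 \<inter> met I P) \<le> length rs * v"
    unfolding v_def by (rule Cons.IH) (use Cons.prems in auto)
  have "set D \<inter> met I P = (set ?D1 \<inter> met I P) \<union> (set ?D2 \<inter> met I P)" by auto
  then have "sum (reward I) (set D \<inter> met I P) =
      sum (reward I) (set ?D1 \<inter> met I P) + sum (reward I) (set ?D2 \<inter> met I P)"
    by (simp only:) (rule sum.union_disjoint; auto)
  then show ?case using 1 2 v by simp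
qed

lemma algorithm_A_good_result:
  fixes I :: "('d, 'r, 'l) mrmd"
  assumes "exact_single_type_algorithm solve T_solve"
    and I: "valid I" "triangle_inequality I" "same_start I"
  shows "good_result I (algorithm_A solve I)"
  unfolding algorithm_A_def
proof (rule good_result_rounds[OF assms])
  show "good_result I (0, [])"
    by (auto simp: good_result_def feasible_plan_iff intro!: exI[of _ "{}"])
qed (use I(1) in \<open>auto simp: valid_def sorted_sort_key\<close>)

lemma total_reward_le_algorithm_A:
  fixes I :: "('d, 'r, 'l) mrmd"
  assumes "exact_single_type_algorithm solve T_solve"
    and I: "valid I" "triangle_inequality I" and "feasible I P"
  shows "total_reward I P \<le> length (types I) * fst (algorithm_A solve I)"
proof -
  have "total_reward I P = sum (reward I) (set (demands I) \<inter> met I P)"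
    unfolding total_reward_def by (rule sum.cong) (auto simp: met_def)
  also have "\<dots> \<le> length (sort_key (num_resources I) (types I)) * fst (algorithm_A solve I)"
    unfolding algorithm_A_def
    by (rule met_reward_le_rounds[OF assms])
      (use I(1) in \<open>fastforce simp: valid_def neq_Nil_conv\<close>)+
  finally show ?thesis by simp
qed

section \<open>Travel costs\<close>

lemma truncate_simps [simp]:
  "demands (mrmd.truncate I) = demands I"
  "types (mrmd.truncate I) = types I"
  "starts (mrmd.truncate I) = starts I"
  "num (mrmd.truncate I) = num I"
  "req (mrmd.truncate I) = req I"
  "start_time (mrmd.truncate I) = start_time I"
  "duration (mrmd.truncate I) = duration I"
  "reward (mrmd.truncate I) = reward I"
  "dloc (mrmd.truncate I) = dloc I"
  "travel (mrmd.truncate I) = travel I"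
  by (simp_all add: mrmd.truncate_def)

lemma on_time_truncate [simp]: "on_time (mrmd.truncate I) x t p = on_time I x t p"
  by (induction p arbitrary: x t) auto

lemma truncate_derived [simp]:
  "valid (mrmd.truncate I) = valid I"
  "demand_locations (mrmd.truncate I) = demand_locations I"
  "locations (mrmd.truncate I) = locations I"
  "triangle_inequality (mrmd.truncate I) = triangle_inequality I"
  "resources (mrmd.truncate I) = resources I"
  "same_start (mrmd.truncate I) = same_start I"
  "is_path (mrmd.truncate I) = is_path I"
  "feasible (mrmd.truncate I) = feasible I"
  "met (mrmd.truncate I) = met I"
  "total_reward (mrmd.truncate I) = total_reward I"
  "feasible_plan (mrmd.truncate I) = feasible_plan I"
  "mrmd_size (mrmd.truncate I) = mrmd_size I"
proof -
  show 1: "valid (mrmd.truncate I) = valid I"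
    by (simp add: valid_def)
  show 2: "demand_locations (mrmd.truncate I) = demand_locations I"
    by (simp add: demand_locations_def)
  then show 3: "locations (mrmd.truncate I) = locations I"
    by (simp add: locations_def)
  with 2 show "triangle_inequality (mrmd.truncate I) = triangle_inequality I"
    by (simp add: triangle_inequality_def)
  show 4: "resources (mrmd.truncate I) = resources I"
    by (simp add: resources_def)
  then show "same_start (mrmd.truncate I) = same_start I"
    by (simp add: same_start_def)
  show 5: "is_path (mrmd.truncate I) = is_path I"
  proof (intro ext)
    fix \<rho> p
    show "is_path (mrmd.truncate I) \<rho> p = is_path I \<rho> p"
      by (cases \<rho>) (simp add: is_path_iff)
  qed
  with 4 show 6: "feasible (mrmd.truncate I) = feasible I"
    by (intro ext) (simp add: feasible_def)
  show 7: "met (mrmd.truncate I) = met I"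
    using 4 by (simp add: met_def fun_eq_iff)
  then show "total_reward (mrmd.truncate I) = total_reward I"
    by (simp add: total_reward_def fun_eq_iff)
  show "feasible_plan (mrmd.truncate I) = feasible_plan I"
    using 4 6 by (simp add: feasible_plan_def fun_eq_iff)
  show "mrmd_size (mrmd.truncate I) = mrmd_size I"
    using 2 3 by (simp add: mrmd_size_def)
qed

section \<open>The optimum with travel costs\<close>

lemma net_reward_cong:
  assumes "\<And>\<rho>. \<rho> \<in> resources I \<Longrightarrow> P \<rho> = P' \<rho>"
  shows "net_reward I P = net_reward I P'"
proof -
  have "met I P = met I P'" using assms by (auto simp: met_def)
  moreover have "(\<Sum>(r, s, k)\<in>resources I. path_cost I s (P (r, s, k))) =
      (\<Sum>(r, s, k)\<in>resources I. path_cost I s (P' (r, s, k)))"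
    by (rule sum.cong) (auto simp: assms)
  ultimately show ?thesis by (simp add: net_reward_def total_reward_def)
qed

text \<open>Up to its values outside \<open>resources I\<close>, a feasible schedule maps finitely
  many resources to duplicate-free lists of demands, so there are finitely many cases.\<close>

lemma finite_net_rewards:
  assumes "valid I"
  shows "finite {net_reward I P |P. feasible I P}"
proof -
  let ?paths = "{p. set p \<subseteq> set (demands I) \<and> distinct p}"
  have "net_reward I P \<in> net_reward I ` (resources I \<rightarrow>\<^sub>E ?paths)" if "feasible I P" for P
  proof
    show "net_reward I P = net_reward I (restrict P (resources I))"
      by (rule net_reward_cong) simp
    have "P \<rho> \<in> ?paths" if "\<rho> \<in> resources I" for \<rho>
    proof -
      have "is_path I \<rho> (P \<rho>)" using that \<open>feasible I P\<close> by (simp add: feasible_def)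
      then show ?thesis
        using is_path_distinct[OF assms] by (cases \<rho>) (auto simp: is_path_iff)
    qed
    then show "restrict P (resources I) \<in> resources I \<rightarrow>\<^sub>E ?paths" by auto
  qed
  then have "{net_reward I P |P. feasible I P} \<subseteq> net_reward I ` (resources I \<rightarrow>\<^sub>E ?paths)"
    by blast
  moreover have "finite (resources I \<rightarrow>\<^sub>E ?paths)"
    by (intro finite_PiE finite_resources finite_subset_distinct) simp
  ultimately show ?thesis
    using finite_subset by blast
qed

lemma net_reward_le: "net_reward I P \<le> int (total_reward I P)"
  by (simp add: net_reward_def del: of_nat_sum)

text \<open>Travel costs only lower the objective, so a bound on rewards bounds the optimum. The
  all-empty schedule shows that the maximum is over a nonempty set.\<close>

lemma opt_mrmdc_le:
  assumes "valid I" "\<And>P. feasible I P \<Longrightarrow> int (total_reward I P) \<le> B"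
  shows "opt_mrmdc I \<le> B"
  unfolding opt_mrmdc_def
proof (subst Max_le_iff)
  have "feasible I (\<lambda>_. [])" by (auto simp: feasible_def is_path_iff)
  then show "{net_reward I P |P. feasible I P} \<noteq> {}" by blast
  show "\<forall>a\<in>{net_reward I P |P. feasible I P}. a \<le> B"
    using assms(2) by (auto intro: order_trans[OF net_reward_le])
qed (rule finite_net_rewards[OF assms(1)])

lemma path_cost_le:
  fixes C :: real
  assumes "\<forall>x\<in>locations I. \<forall>y\<in>demand_locations I. real (cost I x y) \<le> C"
  shows "x \<in> locations I \<Longrightarrow> set p \<subseteq> set (demands I) \<Longrightarrow> real (path_cost I x p) \<le> C * length p"
proof (induction p arbitrary: x)
  case (Cons d p)
  have d: "dloc I d \<in> demand_locations I" "dloc I d \<in> locations I"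
    using Cons.prems(2) by (auto simp: demand_locations_def locations_def)
  have "real (cost I x (dloc I d)) \<le> C" using assms Cons.prems(1) d(1) by blast
  moreover have "real (path_cost I (dloc I d) p) \<le> C * length p"
    using Cons.IH[OF d(2)] Cons.prems(2) by simp
  ultimately show ?case by (simp add: algebra_simps)
qed simp

text \<open>Each visit is paid for by exactly one trip. Unlisted resources stay idle, so the sum
  over all resources collapses to the entries of the plan.\<close>

lemma travel_cost_le:
  fixes C :: real
  assumes C: "\<forall>x\<in>locations I. \<forall>y\<in>demand_locations I. real (cost I x y) \<le> C"
    and Y: "feasible_plan I Y"
  shows "real (\<Sum>(r, s, k)\<in>resources I. path_cost I s (schedule_of Y (r, s, k))) \<le>
    C * length (concat (map snd Y))"
proof -
  have dist: "distinct (map fst Y)" using Y by (simp add: feasible_plan_def)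
  have "real (\<Sum>(r, s, k)\<in>resources I. path_cost I s (schedule_of Y (r, s, k))) \<le>
      (\<Sum>\<rho>\<in>resources I. C * length (schedule_of Y \<rho>))"
    unfolding of_nat_sum
  proof (rule sum_mono, clarsimp)
    fix r s k assume \<rho>: "(r, s, k) \<in> resources I"
    with Y have "is_path I (r, s, k) (schedule_of Y (r, s, k))"
      by (auto simp: feasible_plan_def feasible_def)
    then show "real (path_cost I s (schedule_of Y (r, s, k))) \<le>
        C * length (schedule_of Y (r, s, k))"
      using path_cost_le[OF C resources_locations[OF \<rho>]] by (auto simp: is_path_iff)
  qed
  also have "\<dots> = C * (\<Sum>\<rho>\<in>resources I. length (schedule_of Y \<rho>))"
    by (simp add: sum_distrib_left)
  also have "(\<Sum>\<rho>\<in>resources I. length (schedule_of Y \<rho>)) =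
      (\<Sum>\<rho>\<in>fst ` set Y. length (schedule_of Y \<rho>))"
  proof (rule sum.mono_neutral_right)
    show "\<forall>\<rho>\<in>resources I - fst ` set Y. length (schedule_of Y \<rho>) = 0"
      by (auto simp: schedule_of_def split: option.splits dest!: map_of_SomeD) force
  qed (use Y in \<open>auto simp: feasible_plan_def finite_resources\<close>)
  also have "\<dots> = (\<Sum>\<rho>\<leftarrow>map fst Y. length (schedule_of Y \<rho>))"
    using sum_list_distinct_conv_sum_set[OF dist, of "\<lambda>\<rho>. length (schedule_of Y \<rho>)"] by simp
  also have "\<dots> = length (concat (map snd Y))"
    unfolding length_concat map_map
    by (rule arg_cong[where f = sum_list], rule map_cong) (auto simp: schedule_of_eq[OF dist])
  finally show ?thesis .
qed

text \<open>With n types there are at most n * |V| trips, each costing at most 1/(2n) of the minimum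
  reward, while \<open>V\<close> earns at least |V| times that reward. Travel thus consumes at most
  half of \<open>v\<close>.\<close>

lemma net_reward_good_result:
  fixes I :: "('d, 'r, 'l) mrmdc"
  assumes C: "\<forall>x\<in>locations I. \<forall>y\<in>demand_locations I.
      real (cost I x y) \<le> 1 / (2 * real (length (types I))) * real (min_reward I)"
    and Y: "good_result (mrmd.truncate I) (v, Y)"
  shows "real v \<le> 2 * real_of_int (net_reward I (schedule_of Y))"
proof (cases "types I = []")
  \<comment> \<open>Without types there are no resources and nothing is paid. The case is separate
    because the computation below divides by the number of types.\<close>
  case True
  have len: "length (concat (map snd Y)) = 0" and feas: "feasible_plan I Y"
    using Y True by (auto simp: good_result_def)
  obtain V where V: "V \<subseteq> met I (schedule_of Y)" "v = sum (reward I) V"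
    using Y by (auto simp: good_result_def)
  have "sum (reward I) V \<le> total_reward I (schedule_of Y)"
    unfolding total_reward_def by (intro sum_mono2 finite_met V) auto
  moreover have "resources I = {}"
    using True by (simp add: resources_def)
  ultimately show ?thesis using V(2) by (simp add: net_reward_def del: of_nat_sum)
next
  case False
  define n where "n = real (length (types I))"
  have n: "n > 0" using False by (simp add: n_def)
  obtain V where V: "V \<subseteq> met I (schedule_of Y)" "v = sum (reward I) V"
    and len: "length (concat (map snd Y)) \<le> length (types I) * card V"
    and feas: "feasible_plan I Y"
    using Y by (auto simp: good_result_def)
  have VD: "V \<subseteq> set (demands I)" using V(1) by (auto simp: met_def)
  have v: "v \<le> total_reward I (schedule_of Y)"
    unfolding total_reward_def V(2) by (intro sum_mono2 finite_met V(1)) auto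
  \<comment> \<open>If there are no demands, \<open>min_reward I\<close> is the minimum of an empty
    set, but then \<open>V\<close> is empty and the left side is 0.\<close>
  have "card V * min_reward I \<le> v"
  proof -
    have "min_reward I \<le> reward I d" if "d \<in> V" for d
      using that VD by (auto simp: min_reward_def)
    then show ?thesis
      unfolding V(2) using sum_bounded_below[of V "min_reward I" "reward I"] by simp
  qed
  then have min: "real (card V) * real (min_reward I) \<le> real v"
    by (metis of_nat_le_iff of_nat_mult)
  have "real (\<Sum>(r, s, k)\<in>resources I. path_cost I s (schedule_of Y (r, s, k))) \<le>
      1 / (2 * n) * real (min_reward I) * length (concat (map snd Y))"
    unfolding n_def by (rule travel_cost_le[OF C feas])
  also have "\<dots> \<le> 1 / (2 * n) * real (min_reward I) * (n * card V)"
    using len n unfolding n_def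
    by (intro mult_left_mono) (simp_all flip: of_nat_mult)
  also have "\<dots> = real (card V) * real (min_reward I) / 2"
    using n by simp
  also have "\<dots> \<le> real v / 2" using min by simp
  finally show ?thesis using v by (simp add: net_reward_def)
qed

text \<open>The factor 2|R| is a product: |R| is lost by keeping only the best round, and 2 by
  paying for travel.\<close>

lemma algorithm_A_approximation:
  fixes I :: "('d, 'r, 'l) mrmdc"
  assumes exact: "exact_single_type_algorithm solve T_solve"
    and I: "valid I" "triangle_inequality I" "same_start I"
    and C: "\<forall>x\<in>locations I. \<forall>y\<in>demand_locations I.
      real (cost I x y) \<le> 1 / (2 * real (length (types I))) * real (min_reward I)"
  defines "Y \<equiv> snd (algorithm_A solve (mrmd.truncate I))"
  shows "feasible_plan I Y"
    and "1 / (2 * real (length (types I))) * real_of_int (opt_mrmdc I) \<le>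
      real_of_int (net_reward I (schedule_of Y))"
proof -
  define v where "v = fst (algorithm_A solve (mrmd.truncate I))"
  have good: "good_result (mrmd.truncate I) (v, Y)"
    unfolding v_def Y_def using algorithm_A_good_result[OF exact] I by simp
  then show "feasible_plan I Y" by (simp add: good_result_def)
  have "opt_mrmdc I \<le> int (length (types I) * v)"
    unfolding v_def
    using total_reward_le_algorithm_A[OF exact, of "mrmd.truncate I"] I
    by (intro opt_mrmdc_le) (simp_all flip: of_nat_mult)
  then have opt: "real_of_int (opt_mrmdc I) \<le> real (length (types I)) * real v"
    by (metis of_int_le_iff of_int_of_nat_eq of_nat_mult)
  have net: "real v \<le> 2 * real_of_int (net_reward I (schedule_of Y))"
    by (rule net_reward_good_result[OF C good])
  show "1 / (2 * real (length (types I))) * real_of_int (opt_mrmdc I) \<le>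
      real_of_int (net_reward I (schedule_of Y))"
  proof (cases "types I = []")
    case False
    then have "1 / (2 * real (length (types I))) * real_of_int (opt_mrmdc I) \<le> real v / 2"
      using opt by (simp add: field_simps)
    with net show ?thesis by linarith
  \<comment> \<open>Without types the factor is 1 / 0 = 0, so only a nonnegative net reward is
    needed, which \<open>net\<close> provides.\<close>
  qed (use net in simp)
qed

section \<open>Running time\<close>

lemma length_le_sum_list:
  fixes f :: "'a \<Rightarrow> nat"
  assumes "\<And>x. x \<in> set xs \<Longrightarrow> 1 \<le> f x"
  shows "length xs \<le> (\<Sum>x\<leftarrow>xs. f x)"
  using assms by (induction xs) fastforce+

lemma sum_list_map_le:
  fixes f :: "'a \<Rightarrow> nat"
  assumes "\<And>x. x \<in> set xs \<Longrightarrow> f x \<le> B"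
  shows "(\<Sum>x\<leftarrow>xs. f x) \<le> length xs * B"
  using assms by (induction xs) (auto simp: add_mono)

lemma length_demands_le: "length (demands I) \<le> mrmd_size I"
proof -
  have "length (demands I) \<le> (\<Sum>d\<leftarrow>demands I. 1 + length (req I d) +
      bits (start_time I d) + bits (duration I d) + bits (reward I d))"
    by (rule length_le_sum_list) simp
  then show ?thesis unfolding mrmd_size_def by simp
qed

lemma length_types_le: "length (types I) \<le> mrmd_size I"
proof -
  have "length (types I) \<le>
      (\<Sum>r\<leftarrow>types I. 1 + (\<Sum>s\<leftarrow>starts I r. 1 + bits (num I r s)))"
    by (rule length_le_sum_list) simp
  then show ?thesis unfolding mrmd_size_def by simp
qed

lemma length_req_le:
  assumes "d \<in> set (demands I)"
  shows "length (req I d) \<le> mrmd_size I"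
proof -
  have "1 + length (req I d) + bits (start_time I d) + bits (duration I d) + bits (reward I d) \<le>
      (\<Sum>d\<leftarrow>demands I. 1 + length (req I d) +
        bits (start_time I d) + bits (duration I d) + bits (reward I d))"
    by (rule member_le_sum_list) (use assms in auto)
  then show ?thesis unfolding mrmd_size_def by simp
qed

lemma length_starts_le:
  assumes "r \<in> set (types I)"
  shows "length (starts I r) \<le> mrmd_size I"
proof -
  have "length (starts I r) \<le> (\<Sum>s\<leftarrow>starts I r. 1 + bits (num I r s))"
    by (rule length_le_sum_list) simp
  also have "\<dots> \<le> 1 + (\<Sum>s\<leftarrow>starts I r. 1 + bits (num I r s))" by simp
  also have "\<dots> \<le> (\<Sum>r\<leftarrow>types I. 1 + (\<Sum>s\<leftarrow>starts I r. 1 + bits (num I r s)))"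
    by (rule member_le_sum_list) (use assms in auto)
  finally show ?thesis unfolding mrmd_size_def by simp
qed

lemma finite_locations: "finite (locations I)" "finite (demand_locations I)"
  by (auto simp: locations_def demand_locations_def)

text \<open>Needed to bound the subroutine's time in terms of the original instance. Every demand
  requires at least one type, so the replacement \<open>[r]\<close> is never longer than the
  original list.\<close>

lemma mrmd_size_restrict_to_type:
  assumes "valid I" "r \<in> set (types I)" "distinct D" "set D \<subseteq> set (demands I)"
  shows "mrmd_size (restrict_to_type I r D) \<le> mrmd_size I"
proof -
  let ?J = "restrict_to_type I r D"
  have D: "distinct (demands I)" using assms(1) by (simp add: valid_def)
  have req: "1 \<le> length (req I d)" if "d \<in> set (demands I)" for d
    using assms(1) that by (cases "req I d") (auto simp: valid_def)
  have "(\<Sum>d\<leftarrow>D. 1 + length [r] +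
      bits (start_time I d) + bits (duration I d) + bits (reward I d)) \<le>
    (\<Sum>d\<leftarrow>demands I. 1 + length (req I d) +
      bits (start_time I d) + bits (duration I d) + bits (reward I d))"
    unfolding sum_list_distinct_conv_sum_set[OF assms(3)] sum_list_distinct_conv_sum_set[OF D]
  proof (rule order_trans[OF sum_mono sum_mono2])
    fix d assume "d \<in> set D"
    then show "1 + length [r] + bits (start_time I d) + bits (duration I d) + bits (reward I d) \<le>
        1 + length (req I d) + bits (start_time I d) + bits (duration I d) + bits (reward I d)"
      using req[of d] assms(4) by auto
  qed (use assms(4) in auto)
  moreover have "(\<Sum>r\<leftarrow>[r]. 1 + (\<Sum>s\<leftarrow>starts I r. 1 + bits (num I r s))) \<le>
      (\<Sum>r\<leftarrow>types I. 1 + (\<Sum>s\<leftarrow>starts I r. 1 + bits (num I r s)))"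
    using member_le_sum_list[of "1 + (\<Sum>s\<leftarrow>starts I r. 1 + bits (num I r s))"
        "map (\<lambda>r. 1 + (\<Sum>s\<leftarrow>starts I r. 1 + bits (num I r s))) (types I)"] assms(2)
    by auto
  moreover have "(\<Sum>x\<in>locations ?J. \<Sum>y\<in>demand_locations ?J. bits (travel I x y)) \<le>
      (\<Sum>x\<in>locations I. \<Sum>y\<in>demand_locations I. bits (travel I x y))"
    by (rule order_trans[OF sum_mono sum_mono2], rule sum_mono2)
      (use locations_restrict_to_type[OF assms(2,4)] in
        \<open>auto simp: finite_locations demand_locations_restrict_to_type[OF assms(4)]\<close>)
  ultimately show ?thesis unfolding mrmd_size_def by simp
qed

section \<open>Step counts of the auxiliary functions\<close>

lemma poly_nat_mono:
  fixes p :: "nat poly"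
  shows "x \<le> y \<Longrightarrow> poly p x \<le> poly p y"
  by (induction p) (auto intro!: mult_mono)

lemma T_member_le: "T_member x xs \<le> length xs + 1"
  by (induction xs) auto

lemma T_sum_list: "T_sum_list xs = length xs + 1"
  by (induction xs) auto

lemma T_concat: "T_concat xss = length (concat xss) + 2 * length xss + 1"
  by (induction xss) (auto simp: T_append)

lemma T_insort_key_le:
  assumes "\<And>y. y \<in> set (x # xs) \<Longrightarrow> T_f y \<le> B"
  shows "T_insort_key f T_f x xs \<le> length xs * (2 * B + 1) + 1"
  using assms
proof (induction xs)
  case (Cons y ys)
  have "T_f x \<le> B" "T_f y \<le> B" using Cons.prems by auto
  moreover have "T_insort_key f T_f x ys \<le> length ys * (2 * B + 1) + 1"
    by (rule Cons.IH) (use Cons.prems in auto)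
  ultimately show ?case by simp
qed simp

lemma T_sort_key_le:
  assumes "\<And>y. y \<in> set xs \<Longrightarrow> T_f y \<le> B"
  shows "T_sort_key f T_f xs \<le> length xs * (length xs * (2 * B + 1) + 2) + 1"
  using assms
proof (induction xs)
  case (Cons x xs)
  have "T_insort_key f T_f x (sort_key f xs) \<le> length xs * (2 * B + 1) + 1"
    using T_insort_key_le[of x "sort_key f xs" T_f B f] Cons.prems by simp
  then show ?case using Cons by (simp add: algebra_simps)
qed simp

lemma T_filter_member_le:
  assumes "\<And>d. d \<in> set p \<Longrightarrow> length (req I d) \<le> N"
  shows "T_filter (\<lambda>d. T_member q (req I d)) p \<le> length p * (N + 2) + 1"
proof -
  have "T_member q (req I d) \<le> N + 1" if "d \<in> set p" for d
    using T_member_le[of q "req I d"] assms[OF that] by simp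
  then show ?thesis
    using sum_list_map_le[of p "\<lambda>d. T_member q (req I d)" "N + 1"]
    by (simp add: T_filter)
qed

lemma T_fst_snd [simp]: "T_fst z = 0" "T_snd z = 0"
  by (cases z; simp)+

lemma T_plan_value_eq:
  "T_plan_value I X = 3 * length (concat (map snd X)) + 3 * length X + 5"
  unfolding T_plan_value_def
  by (simp only: T_map T_concat T_sum_list length_map) (simp add: T_map sum_list_triv)

lemma T_follow_le:
  assumes "\<And>d. d \<in> set (concat (map snd X)) \<Longrightarrow> length (req I d) \<le> N"
  shows "T_follow I X q \<le> length (concat (map snd X)) * (N + 2) + 3 * length X + 3"
proof -
  have "(\<Sum>(\<rho>, p)\<leftarrow>X. T_filter (\<lambda>d. T_member q (req I d)) p) \<le>
      length (concat (map snd X)) * (N + 2) + length X"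
    using assms
  proof (induction X)
    case (Cons a X)
    obtain \<rho> p where a: "a = (\<rho>, p)" by (cases a)
    show ?case
      using Cons T_filter_member_le[of p I N q] by (simp add: a algebra_simps)
  qed simp
  then show ?thesis
    unfolding T_follow_def T_map T_filter[of "\<lambda>_. 0"] sum_list_0 length_map by simp
qed

section \<open>Step counts of the rounds and of the algorithm\<close>

lemma T_round_le:
  fixes I :: "('d, 'r, 'l) mrmd"
  assumes exact: "exact_single_type_algorithm solve T_solve"
    and I: "valid I" "triangle_inequality I"
    and rs: "distinct (r # rs)" "set (r # rs) \<subseteq> set (types I)"
    and D: "distinct D" "set D \<subseteq> set (demands I)"
    and X: "X = solve (restrict_to_type I r (filter (\<lambda>d. r \<in> set (req I d)) D))"
    and M: "M = mrmd_size I + 2"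
  shows "T_filter (\<lambda>d. T_member q (req I d)) D \<le> M ^ 2"
    and "T_plan_value I X \<le> 6 * M"
    and "T_map (T_follow I X) (r # rs) \<le> 5 * M ^ 3"
    and "T_concat (map (follow I X) (r # rs)) \<le> M ^ 2"
proof -
  define N where "N = mrmd_size I"
  let ?D = "filter (\<lambda>d. r \<in> set (req I d)) D"
  \<comment> \<open>The shift by 2 covers the overhead in \<open>T_filter_member_le\<close> and lets
    powers of \<open>M\<close> absorb all lower-order terms.\<close>
  have MN: "M = N + 2" by (simp add: M N_def)
  have r: "r \<in> set (types I)" using rs by simp
  have req: "length (req I d) \<le> N" if "d \<in> set D" for d
    using length_req_le[of d I] that D(2) by (auto simp: N_def)
  have "length D = card (set D)" using D(1) by (simp add: distinct_card)
  also have "\<dots> \<le> card (set (demands I))" by (rule card_mono) (use D in auto)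
  also have "\<dots> \<le> N"
    using length_demands_le[of I] card_length[of "demands I"] by (simp add: N_def)
  finally have lenD: "length D \<le> N" .
  have "length (r # rs) = card (set (r # rs))" using rs(1) distinct_card by metis
  also have "\<dots> \<le> card (set (types I))" by (rule card_mono) (use rs in auto)
  also have "\<dots> \<le> N"
    using length_types_le[of I] card_length[of "types I"] by (simp add: N_def)
  finally have lenR: "length (r # rs) \<le> N" .
  have DD: "distinct ?D" "set ?D \<subseteq> set (demands I)" using D by auto
  note round = solve_round[OF exact I r DD X]
  have "length (concat (map snd X)) = card (set (concat (map snd X)))"
    using round(2) by (rule distinct_card[symmetric])
  also have "\<dots> \<le> card (set D)"
    by (rule card_mono) (use round(3) in auto)
  also have "\<dots> \<le> N" using card_length[of D] lenD by simp
  finally have c: "length (concat (map snd X)) \<le> N" .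
  \<comment> \<open>Only nonempty paths are listed, so the number of entries is bounded by the
    number of visits, however many resources there are.\<close>
  have "length X \<le> (\<Sum>z\<leftarrow>X. length (snd z))"
  proof (rule length_le_sum_list)
    fix z assume "z \<in> set X"
    then have "snd z \<noteq> []" using round(1) by (auto simp: feasible_plan_iff)
    then show "1 \<le> length (snd z)" by (cases "snd z") auto
  qed
  then have lenX: "length X \<le> N"
    using c by (simp add: length_concat comp_def)

  have "T_filter (\<lambda>d. T_member q (req I d)) D \<le> length D * (N + 2) + 1"
    by (rule T_filter_member_le) (use req in auto)
  also have "\<dots> \<le> N * M + 1"
    unfolding MN using lenD by (intro add_mono mult_mono) auto
  also have "\<dots> \<le> M ^ 2" by (simp add: MN power2_eq_square)
  finally show "T_filter (\<lambda>d. T_member q (req I d)) D \<le> M ^ 2" .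

  show "T_plan_value I X \<le> 6 * M"
    unfolding T_plan_value_eq MN using c lenX by simp

  have follow: "T_follow I X q \<le> 4 * M ^ 2" for q
  proof -
    have "T_follow I X q \<le> length (concat (map snd X)) * (N + 2) + 3 * length X + 3"
      by (rule T_follow_le) (use round(3) req in force)
    also have "\<dots> \<le> N * (N + 2) + 3 * N + 3"
      using c lenX by (intro add_mono mult_mono) auto
    also have "\<dots> \<le> 4 * M ^ 2" by (simp add: MN power2_eq_square algebra_simps)
    finally show ?thesis .
  qed
  have "T_map (T_follow I X) (r # rs) \<le> length (r # rs) * (4 * M ^ 2) + length (r # rs) + 1"
    unfolding T_map by (intro add_mono sum_list_map_le follow order_refl)
  also have "\<dots> \<le> N * (4 * M ^ 2) + N + 1"
    by (intro add_mono mult_mono lenR) auto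
  also have "\<dots> \<le> 5 * M ^ 3"
    by (simp add: MN power2_eq_square power3_eq_cube algebra_simps)
  finally show "T_map (T_follow I X) (r # rs) \<le> 5 * M ^ 3" .

  have "length (concat (map (follow I X) (r # rs))) = (\<Sum>q\<leftarrow>r # rs. length (follow I X q))"
    by (simp add: length_concat comp_def)
  also have "\<dots> \<le> length (r # rs) * N"
  proof (rule sum_list_map_le)
    fix q
    show "length (follow I X q) \<le> N"
      unfolding follow_def using lenX le_trans[OF length_filter_le] by auto
  qed
  also have "\<dots> \<le> N * N"
    by (intro mult_mono lenR) auto
  finally have "T_concat (map (follow I X) (r # rs)) \<le> N * N + 2 * N + 1"
    unfolding T_concat length_map using lenR by linarith
  also have "\<dots> \<le> M ^ 2" by (simp add: MN power2_eq_square algebra_simps)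
  finally show "T_concat (map (follow I X) (r # rs)) \<le> M ^ 2" .
qed

text \<open>The bound for one round depends neither on the current demands nor on the record, so
  induction multiplies it by the number of rounds.\<close>

lemma T_rounds_le:
  fixes I :: "('d, 'r, 'l) mrmd"
  assumes exact: "exact_single_type_algorithm solve T_solve"
    and p: "\<And>J. J \<in> single_type_instances \<Longrightarrow> T_solve J \<le> poly p (mrmd_size J)"
    and I: "valid I" "triangle_inequality I"
    and M: "M = mrmd_size I + 2"
  shows "distinct rs \<Longrightarrow> set rs \<subseteq> set (types I) \<Longrightarrow>
    distinct D \<Longrightarrow> set D \<subseteq> set (demands I) \<Longrightarrow>
    T_rounds solve T_solve I rs D best \<le>
      length rs * (16 * M ^ 3 + poly p (mrmd_size I)) + 1"
proof (induction rs arbitrary: D best)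
  case (Cons r rs)
  let ?D = "filter (\<lambda>d. r \<in> set (req I d)) D" and ?D' = "filter (\<lambda>d. r \<notin> set (req I d)) D"
  let ?J = "restrict_to_type I r ?D"
  let ?X = "solve ?J"
  define best' where "best' =
    (if plan_value I ?X \<ge> fst best
     then (plan_value I ?X, concat (map (follow I ?X) (r # rs))) else best)"
  define A where "A = T_filter (\<lambda>d. T_member r (req I d)) D"
  define B where "B = T_plan_value I ?X"
  define E where "E = T_map (T_follow I ?X) (r # rs)"
  define F where "F = T_concat (map (follow I ?X) (r # rs))"
  define S where "S = mrmd_size ?J"
  define U where "U = T_solve ?J"
  define W where "W = T_rounds solve T_solve I rs ?D' best'"
  have eq: "T_rounds solve T_solve I (r # rs) D best =
      A + S + U + B + A + (if plan_value I ?X \<ge> fst best then E + F else 0) + W + 1"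
    unfolding T_rounds.simps Let_def best'_def A_def B_def E_def F_def S_def U_def W_def by simp
  have r: "r \<in> set (types I)" using Cons.prems by simp
  have D: "distinct ?D" "set ?D \<subseteq> set (demands I)" using Cons.prems by auto
  note bounds = T_round_le[OF exact I Cons.prems refl M]
  have S: "S \<le> mrmd_size I"
    unfolding S_def by (rule mrmd_size_restrict_to_type[OF I(1) r D])
  have "U \<le> poly p S"
    unfolding U_def S_def by (intro p restrict_to_type_single_type I r D)
  also have "\<dots> \<le> poly p (mrmd_size I)" using S by (rule poly_nat_mono)
  finally have U: "U \<le> poly p (mrmd_size I)" .
  have W: "W \<le> length rs * (16 * M ^ 3 + poly p (mrmd_size I)) + 1"
    unfolding W_def by (rule Cons.IH) (use Cons.prems in auto)
  have "T_rounds solve T_solve I (r # rs) D best \<le> 2 * A + S + U + B + E + F + W + 1"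
    unfolding eq by simp
  \<comment> \<open>With \<open>A\<close> counted twice and the final step counted with
    \<open>S\<close>, these add up to 15 * M ^ 3, within the claimed 16.\<close>
  moreover have "A \<le> M ^ 3" "F \<le> M ^ 3" "B \<le> 6 * M ^ 3" "E \<le> 5 * M ^ 3" "S + 1 \<le> M ^ 3"
  proof -
    have M1: "M \<ge> 1" using M by simp
    have 23: "M ^ 2 \<le> M ^ 3" and 13: "M \<le> M ^ 3"
      using M1 power_increasing[of 2 3 M] power_increasing[of 1 3 M] by auto
    show "A \<le> M ^ 3" using bounds(1) 23 unfolding A_def by (rule order_trans)
    show "F \<le> M ^ 3" using bounds(4) 23 unfolding F_def by (rule order_trans)
    show "B \<le> 6 * M ^ 3" using bounds(2) 13 unfolding B_def by linarith
    show "E \<le> 5 * M ^ 3" using bounds(3) unfolding E_def .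
    show "S + 1 \<le> M ^ 3" using S M 13 by linarith
  qed
  ultimately have "T_rounds solve T_solve I (r # rs) D best \<le>
      16 * M ^ 3 + poly p (mrmd_size I) + W"
    using U by linarith
  then show ?case using W by simp
qed simp

lemma T_algorithm_A_le:
  fixes I :: "('d, 'r, 'l) mrmd"
  assumes exact: "exact_single_type_algorithm solve T_solve"
    and p: "\<And>J. J \<in> single_type_instances \<Longrightarrow> T_solve J \<le> poly p (mrmd_size J)"
    and I: "valid I" "triangle_inequality I"
  shows "T_algorithm_A solve T_solve I \<le>
    poly ([:2, 1:] * (smult 26 ([:2, 1:] ^ 3) + p)) (mrmd_size I)"
proof -
  define N M where "N = mrmd_size I" and "M = N + 2"
  let ?rs = "sort_key (num_resources I) (types I)"
  have types: "length (types I) \<le> N" by (simp add: N_def length_types_le)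
  have "T_num_resources I r \<le> 2 * M" if "r \<in> set (types I)" for r
    using length_starts_le[OF that]
    by (simp add: T_num_resources_def T_map T_sum_list sum_list_triv M_def N_def)
  then have "T_sort_key (num_resources I) (T_num_resources I) (types I) \<le>
      length (types I) * (length (types I) * (2 * (2 * M) + 1) + 2) + 1"
    by (rule T_sort_key_le)
  also have "\<dots> \<le> N * (N * (2 * (2 * M) + 1) + 2) + 1"
    using types by (intro add_mono mult_mono) auto
  also have "\<dots> \<le> 8 * M ^ 3"
    by (simp add: M_def power3_eq_cube algebra_simps)
  finally have sort: "T_sort_key (num_resources I) (T_num_resources I) (types I) \<le> 8 * M ^ 3" .
  have "T_rounds solve T_solve I ?rs (demands I) (0, []) \<le>
      length ?rs * (16 * M ^ 3 + poly p N) + 1"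
    unfolding N_def
    by (rule T_rounds_le[OF exact p I]) (use I(1) in \<open>auto simp: valid_def M_def N_def\<close>)
  also have "\<dots> \<le> N * (16 * M ^ 3 + poly p N) + 1"
    using types by (intro add_mono mult_mono) auto
  finally have "T_algorithm_A solve T_solve I \<le> 8 * M ^ 3 + N * (16 * M ^ 3 + poly p N) + 2"
    using sort by (simp add: T_algorithm_A_def)
  also have "\<dots> \<le> M * (26 * M ^ 3 + poly p N)"
  proof -
    \<comment> \<open>The factor \<open>N + 2\<close> contributes two extra copies of 26 *
      \<open>Q\<close>, which absorb the sorting cost 8 * \<open>Q\<close> and the constant
      2.\<close>
    have "8 * Q + N * (16 * Q + P) + 2 \<le> (N + 2) * (26 * Q + P)" if "1 \<le> Q" for P Q :: nat
      using that by (simp add: algebra_simps)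
    from this[of "M ^ 3" "poly p N"] show ?thesis by (simp add: M_def)
  qed
  also have "\<dots> = poly ([:2, 1:] * (smult 26 ([:2, 1:] ^ 3) + p)) N"
    by (simp add: M_def algebra_simps)
  finally show ?thesis by (simp only: N_def)
qed

theorem theorem12:
  fixes solve :: "('d, 'r, 'l) mrmd \<Rightarrow> ('d, 'r, 'l) plan"
    and T_solve :: "('d, 'r, 'l) mrmd \<Rightarrow> nat"
  assumes "exact_single_type_algorithm solve T_solve"
  shows "approximation_algorithm
           {I :: ('d, 'r, 'l) mrmdc.
              valid I \<and> triangle_inequality I \<and> same_start I \<and>
              (\<forall>x\<in>locations I. \<forall>y\<in>demand_locations I.
                 real (cost I x y) \<le> 1 / (2 * real (length (types I))) * real (min_reward I))}
           (\<lambda>I. 2 * real (length (types I)))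
           (\<lambda>I. snd (algorithm_A solve (mrmd.truncate I)))
           (\<lambda>I. T_algorithm_A solve T_solve (mrmd.truncate I))"
proof -
  obtain p where p: "\<And>J. J \<in> single_type_instances \<Longrightarrow> T_solve J \<le> poly p (mrmd_size J)"
    using assms unfolding exact_single_type_algorithm_def polynomial_time_on_def by blast
  let ?p = "[:2, 1:] * (smult 26 ([:2, 1:] ^ 3) + p)"
  have time: "T_algorithm_A solve T_solve (mrmd.truncate I) \<le> poly ?p (mrmdc_size I)"
    if "valid I" "triangle_inequality I" for I :: "('d, 'r, 'l) mrmdc"
  proof -
    have "T_algorithm_A solve T_solve (mrmd.truncate I) \<le>
        poly ?p (mrmd_size (mrmd.truncate I))"
      by (rule T_algorithm_A_le[OF assms p]) (use that in auto)
    \<comment> \<open>The encoding of the travel costs only enlarges the instance.\<close>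
    also have "\<dots> \<le> poly ?p (mrmdc_size I)"
      by (rule poly_nat_mono) (simp add: mrmdc_size_def)
    finally show ?thesis .
  qed
  show ?thesis
    unfolding approximation_algorithm_def polynomial_time_on_def
    by (intro conjI ballI exI[of _ ?p])
      (use time algorithm_A_approximation[OF assms] in blast)+
qed

end
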